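(* Let $T\in\mathbb{R}^{n\times n}$ be an irreducible matrix satisfying either property (T1) or property (T2), and let $b\in\mathbb{R}^n$. Then the piecewise linear system $$[\,I+TP(x)\,]\,x=b$$ has a unique solution $x^*\in\mathbb{R}^n$, and the iteration $$P^0=O,\qquad (I+TP^k)\,x^{k+1}=b,\qquad P^{k+1}=P(x^{k+1}),\qquad k=0,1,\dots,$$ is well defined and converges to $x^*$ in a finite number of steps, i.e. there exists $K$ such that $x^k=x^*$ for all $k\ge K$.
   Context: For $x\in\mathbb{R}^n$, $P(x)$ is the diagonal matrix $\mathrm{diag}(p(x_1),\dots,p(x_n))$ with $p(x_i)=1$ if $x_i\ge 0$ and $p(x_i)=0$ otherwise. The superscript $k$ is an iteration index, not a power. All inequalities between vectors or matrices are componentwise; $O$ is the zero matrix. An $M$-matrix is a real square matrix that can be written as $\alpha I-B$ with $B\ge O$ and spectral radius $\rho(B)<\alpha$. Property (T1): $T$ is an $M$-matrix. Property (T2): $\mathrm{null}(T^T)=\mathrm{span}(v)$ and $\mathrm{null}(T)=\mathrm{span}(w)$ for some vectors $v,w>0$ (componentwise), and $T+D$ is an $M$-matrix for every diagonal matrix $D\ge O$ with $D\ne O$. *)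

theory Defs
  imports "HOL-Analysis.Analysis"
begin

text \<open>
  Vectors and matrices of arbitrary size carry the componentwise order \<open>\<le>\<close> of the library.
  The library's \<open><\<close> on vectors is not the strict componentwise order, so
  componentwise positivity is written out below.
\<close>

text \<open>The spectrum of a real matrix consists of all its complex eigenvalues.\<close>

definition spectrum :: "real^'n^'n \<Rightarrow> complex set" where
  "spectrum A = {\<mu>. \<exists>v :: complex^'n. v \<noteq> 0 \<and> (\<chi> i j. complex_of_real (A$i$j)) *v v = \<mu> *s v}"

text \<open>The spectrum is finite and nonempty, so this supremum is a maximum.\<close>

definition spectral_radius :: "real^'n^'n \<Rightarrow> real" where
  "spectral_radius A = (SUP \<mu>\<in>spectrum A. norm \<mu>)"

definition M_matrix :: "real^'n^'n \<Rightarrow> bool" where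
  "M_matrix A \<longleftrightarrow> (\<exists>\<alpha> B. A = \<alpha> *\<^sub>R mat 1 - B \<and> 0 \<le> B \<and> spectral_radius B < \<alpha>)"

text \<open>
  A simultaneous permutation of rows and columns brings \<open>A\<close> to block triangular form with
  two nonempty square diagonal blocks iff, for the index set \<open>S\<close> of one of the two blocks,
  the entries with row in \<open>S\<close> and column outside \<open>S\<close> all vanish. Every \<open>1 \<times> 1\<close> matrix is
  irreducible, including the zero matrix.
\<close>

definition reducible_matrix :: "real^'n^'n \<Rightarrow> bool" where
  "reducible_matrix A \<longleftrightarrow>
     (\<exists>S. S \<noteq> {} \<and> S \<noteq> UNIV \<and> (\<forall>i\<in>S. \<forall>j\<in>-S. A$i$j = 0))"

definition irreducible_matrix :: "real^'n^'n \<Rightarrow> bool" where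
  "irreducible_matrix A \<longleftrightarrow> \<not> reducible_matrix A"

definition diagonal_matrix :: "real^'n^'n \<Rightarrow> bool" where
  "diagonal_matrix D \<longleftrightarrow> (\<forall>i j. i \<noteq> j \<longrightarrow> D$i$j = 0)"

definition null_space :: "real^'n^'m \<Rightarrow> (real^'n) set" where
  "null_space A = {x. A *v x = 0}"

definition property_T1 :: "real^'n^'n \<Rightarrow> bool" where
  "property_T1 T \<longleftrightarrow> M_matrix T"

definition property_T2 :: "real^'n^'n \<Rightarrow> bool" where
  "property_T2 T \<longleftrightarrow>
     (\<exists>v w. (\<forall>i. 0 < v$i) \<and> (\<forall>i. 0 < w$i) \<and>
        null_space (transpose T) = span {v} \<and> null_space T = span {w}) \<and>
     (\<forall>D. diagonal_matrix D \<and> 0 \<le> D \<and> D \<noteq> 0 \<longrightarrow> M_matrix (T + D))"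

definition P_matrix :: "real^'n \<Rightarrow> real^'n^'n" where
  "P_matrix x = (\<chi> i j. if i = j \<and> 0 \<le> x$i then 1 else 0)"

definition solves_pls :: "real^'n^'n \<Rightarrow> real^'n \<Rightarrow> real^'n \<Rightarrow> bool" where
  "solves_pls T b x \<longleftrightarrow> (mat 1 + T ** P_matrix x) *v x = b"

text \<open>
  \<open>Ps k\<close> and \<open>xs k\<close> are the \<open>k\<close>-th iterates; the iteration starts from \<open>Ps 0\<close>,
  and \<open>xs 0\<close> is not constrained.
\<close>

definition is_iteration ::
  "real^'n^'n \<Rightarrow> real^'n \<Rightarrow> (nat \<Rightarrow> real^'n^'n) \<Rightarrow> (nat \<Rightarrow> real^'n) \<Rightarrow> bool" where
  "is_iteration T b Ps xs \<longleftrightarrow>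
     Ps 0 = 0 \<and>
     (\<forall>k. (mat 1 + T ** Ps k) *v xs (Suc k) = b \<and> Ps (Suc k) = P_matrix (xs (Suc k)))"

end

theory Submission
  imports Defs
begin

text \<open>
  The substitution \<open>z = P(x) x = max(x, 0)\<close>, \<open>x = b - T z\<close> turns the system into the
  complementarity problem \<open>min(z, (I + T) z - b) = 0\<close>. Row by row the minimum picks either
  \<open>z$i\<close> or \<open>((I + T) z - b)$i = z$i - x$i\<close>, so it equals \<open>(I + P T) z - P b\<close> minimised over
  all 0/1 diagonal matrices \<open>P\<close>, and the minimum at \<open>z\<close> is attained by \<open>P = P(x)\<close>. The given
  iteration is policy iteration for this problem: \<open>z\<^sup>k\<^sup>+\<^sup>1 = P\<^sup>k x\<^sup>k\<^sup>+\<^sup>1\<close> solves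
  \<open>(I + P\<^sup>k T) z = P\<^sup>k b\<close>.

  Everything rests on the fact that each \<open>I + P T\<close> is inverse-nonnegative. For this it suffices
  that \<open>T\<close> has nonpositive off-diagonal entries and that \<open>T w \<ge> 0\<close> for some \<open>w > 0\<close>, since
  then \<open>(I + P T) w \<ge> w > 0\<close> (lemma \<open>Z_matrix_monotone\<close>). Optimality of \<open>P\<^sup>k\<close> gives
  \<open>(I + P\<^sup>k T) (z\<^sup>k\<^sup>+\<^sup>1 - z\<^sup>k) \<ge> 0\<close>, so the \<open>z\<^sup>k\<close> increase from \<open>k = 1\<close> on; as there are only
  finitely many matrices \<open>P\<close>, they become stationary, and a stationary iterate solves the system.
  The same comparison gives uniqueness.

  Under (T2) the vector \<open>w\<close> is the given null vector. Under (T1), write \<open>T = \<alpha> I - B\<close>; the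
  infimum \<open>t\<close> of all \<open>s\<close> admitting a \<open>u > 0\<close> with \<open>B u < s u\<close> is an eigenvalue of \<open>B\<close> (lemma
  \<open>nonneg_matrix_Perron_value\<close>), so \<open>t \<le> \<rho>(B) < \<alpha>\<close> and \<open>\<alpha>\<close> itself admits such a \<open>u\<close>.
\<close>

section \<open>Monotone Z-matrices\<close>

text \<open>
  If \<open>x\<close> had a negative entry, then at an index \<open>i\<close> minimising \<open>x$i / w$i = c < 0\<close> the sign pattern
  would give \<open>(A x)$i \<le> c (A w)$i < 0\<close>.
\<close>

lemma Z_matrix_monotone:
  fixes A :: "real^'n^'n"
  assumes off: "\<And>i j. i \<noteq> j \<Longrightarrow> A$i$j \<le> 0"
    and w: "\<And>i. 0 < w$i" and Aw: "\<And>i. 0 < (A *v w)$i"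
    and Ax: "\<And>i. 0 \<le> (A *v x)$i"
  shows "0 \<le> x$k"
proof (rule ccontr)
  assume neg: "\<not> 0 \<le> x$k"
  define c where "c = Min (range (\<lambda>i. x$i / w$i))"
  have "c \<in> range (\<lambda>i. x$i / w$i)"
    unfolding c_def by (rule Min_in) auto
  then obtain i where i: "c = x$i / w$i" by auto
  have c_le: "c \<le> x$j / w$j" for j
    unfolding c_def by (rule Min_le) auto
  have lower: "c * w$j \<le> x$j" for j
    using c_le[of j] w[of j] by (simp add: pos_le_divide_eq)
  have "x$k / w$k < 0"
    using neg w[of k] by (simp add: divide_neg_pos)
  then have "c < 0" using c_le[of k] by linarith
  have xi: "x$i = c * w$i" using i w[of i] by simp
  have "A$i$j * x$j \<le> A$i$j * (c * w$j)" for j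
    using xi mult_left_mono_neg[OF lower[of j], of "A$i$j"] off[of i j] by (cases "j = i") auto
  then have "(A *v x)$i \<le> (\<Sum>j\<in>UNIV. A$i$j * (c * w$j))"
    by (auto simp: matrix_vector_mult_def intro: sum_mono)
  also have "\<dots> = c * (A *v w)$i"
    by (simp add: matrix_vector_mult_def sum_distrib_left mult.left_commute)
  also have "\<dots> < 0" using \<open>c < 0\<close> Aw[of i] by (simp add: mult_neg_pos)
  finally show False using Ax[of i] by simp
qed

section \<open>Nonnegative matrices and the spectral radius\<close>

text \<open>
  At an index maximising \<open>norm (v$i)\<close>, the eigenvalue equation bounds \<open>norm \<mu>\<close> by a row sum of
  absolute values; the sum over all entries is a bound that does not mention the index.
\<close>

lemma norm_spectrum_le:
  assumes "\<mu> \<in> spectrum A"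
  shows "norm \<mu> \<le> (\<Sum>i\<in>UNIV. \<Sum>j\<in>UNIV. \<bar>A$i$j\<bar>)"
proof -
  obtain v where v: "v \<noteq> 0" and eq: "(\<chi> i j. complex_of_real (A$i$j)) *v v = \<mu> *s v"
    using assms by (auto simp: spectrum_def)
  define m where "m = Max (range (\<lambda>i. norm (v$i)))"
  have "m \<in> range (\<lambda>i. norm (v$i))"
    unfolding m_def by (rule Max_in) auto
  then obtain i where i: "m = norm (v$i)" by auto
  have le: "norm (v$j) \<le> m" for j
    unfolding m_def by (rule Max_ge) auto
  obtain j where "v$j \<noteq> 0" using v by (auto simp: vec_eq_iff)
  then have "0 < m" using le[of j] by (meson less_le_trans zero_less_norm_iff)
  have "norm \<mu> * m = norm ((\<mu> *s v)$i)" by (simp add: i norm_mult)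
  also have "\<dots> = norm (\<Sum>j\<in>UNIV. complex_of_real (A$i$j) * v$j)"
    unfolding eq[symmetric] by (simp add: matrix_vector_mult_def)
  also have "\<dots> \<le> (\<Sum>j\<in>UNIV. \<bar>A$i$j\<bar> * m)"
    by (rule sum_norm_le) (auto simp: norm_mult intro: mult_left_mono le)
  also have "\<dots> = (\<Sum>j\<in>UNIV. \<bar>A$i$j\<bar>) * m" by (simp add: sum_distrib_right)
  finally have "norm \<mu> \<le> (\<Sum>j\<in>UNIV. \<bar>A$i$j\<bar>)" using \<open>0 < m\<close> by simp
  also have "\<dots> \<le> (\<Sum>i\<in>UNIV. \<Sum>j\<in>UNIV. \<bar>A$i$j\<bar>)"
    by (rule member_le_sum) (auto intro: sum_nonneg)
  finally show ?thesis .
qed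

lemma real_eigenvalue_le_spectral_radius:
  fixes A :: "real^'n^'n"
  assumes "v \<noteq> 0" and eq: "A *v v = t *\<^sub>R v"
  shows "t \<le> spectral_radius A"
proof -
  let ?v = "\<chi> i. complex_of_real (v$i)"
  have "(\<Sum>j\<in>UNIV. A$i$j * v$j) = t * v$i" for i
    using eq by (simp add: vec_eq_iff matrix_vector_mult_def)
  then have "(\<Sum>j\<in>UNIV. complex_of_real (A$i$j) * complex_of_real (v$j)) =
      complex_of_real t * complex_of_real (v$i)" for i
    by (metis (no_types, lifting) of_real_mult of_real_sum sum.cong)
  then have "(\<chi> i j. complex_of_real (A$i$j)) *v ?v = complex_of_real t *s ?v"
    by (simp add: vec_eq_iff matrix_vector_mult_def)
  moreover have "?v \<noteq> 0" using \<open>v \<noteq> 0\<close> by (auto simp: vec_eq_iff)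
  ultimately have "complex_of_real t \<in> spectrum A" by (auto simp: spectrum_def)
  then have "norm (complex_of_real t) \<le> spectral_radius A"
    unfolding spectral_radius_def
    by (rule cSUP_upper) (auto intro!: bdd_aboveI norm_spectrum_le)
  then show ?thesis by simp
qed

text \<open>
  This is the part of Perron-Frobenius theory that connects the spectral radius with positive test
  vectors. Let \<open>t\<close> be the infimum of the set \<open>S\<close> of all \<open>s\<close> with \<open>B u < s u\<close> for some \<open>u > 0\<close>.
  If \<open>t\<close> were not an eigenvalue, \<open>t u - B u = 1\<close> would have a solution \<open>u\<close>; comparison with an
  element of \<open>S\<close> close to \<open>t\<close> shows \<open>u > 0\<close>, and then \<open>u\<close> puts numbers below \<open>t\<close> into \<open>S\<close>.
\<close>

lemma nonneg_matrix_Perron_value: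
  fixes B :: "real^'n^'n"
  assumes B: "0 \<le> B"
  shows "\<exists>t. (\<exists>v. v \<noteq> 0 \<and> B *v v = t *\<^sub>R v) \<and>
    (\<forall>s>t. \<exists>u. (\<forall>i. 0 < u$i) \<and> (\<forall>i. (B *v u)$i < s * u$i))"
proof -
  define S where "S = {s. \<exists>u. (\<forall>i. 0 < u$i) \<and> (\<forall>i. (B *v u)$i < s * u$i)}"
  define t where "t = Inf S"
  have Bij: "0 \<le> B$i$j" for i j
    using B by (simp add: less_eq_vec_def)
  have Bu: "0 \<le> (B *v u)$i" if "\<And>j. 0 \<le> u$j" for u i
    unfolding matrix_vector_mult_def using Bij that by (auto intro!: sum_nonneg)
  have S_pos: "0 < s" if "s \<in> S" for s
  proof -
    obtain u where u: "\<And>i. 0 < u$i" "\<And>i. (B *v u)$i < s * u$i"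
      using \<open>s \<in> S\<close> by (auto simp: S_def)
    fix i
    have "0 < s * u$i" using Bu[of u i] u less_imp_le le_less_trans by metis
    then show ?thesis using u(1)[of i] by (simp add: zero_less_mult_iff)
  qed
  have S_bdd: "bdd_below S" using S_pos by (auto intro!: bdd_belowI less_imp_le)
  have "1 + (\<Sum>i\<in>UNIV. (B *v 1)$i) \<in> S"
  proof -
    have "(B *v 1)$i < 1 + (\<Sum>i\<in>UNIV. (B *v 1)$i)" for i
      using member_le_sum[of i UNIV "\<lambda>i. (B *v 1)$i"] Bu[of 1] by simp
    then show ?thesis unfolding S_def by (auto intro!: exI[of _ 1])
  qed
  then have S_ne: "S \<noteq> {}" by auto
  have t_nonneg: "0 \<le> t"
    unfolding t_def using S_ne S_pos by (intro cInf_greatest) (auto intro: less_imp_le)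
  have near: "\<exists>s'\<in>S. s' < s" if "t < s" for s
    using that S_ne S_bdd unfolding t_def by (simp add: cInf_less_iff)
  have "\<exists>v. v \<noteq> 0 \<and> B *v v = t *\<^sub>R v"
  proof (rule ccontr)
    assume no: "\<nexists>v. v \<noteq> 0 \<and> B *v v = t *\<^sub>R v"
    let ?f = "\<lambda>v. t *\<^sub>R v - B *v v"
    have lin: "linear ?f"
      by (intro linear_compose_sub linear_scaleR matrix_vector_mul_linear)
    have "v = 0" if "?f v = 0" for v
      using no that by (metis eq_iff_diff_eq_0)
    then have "inj ?f" unfolding linear_injective_0[OF lin] by blast
    then have "surj ?f" by (rule linear_inj_imp_surj[OF lin])
    then obtain u where "?f u = 1" unfolding surj_def by metis
    then have u: "t * u$i - (B *v u)$i = 1" for i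
      by (metis one_index vector_minus_component vector_scaleR_component real_scaleR_def)
    define e where "e = 1 / (2 * (1 + norm u))"
    have "0 < e"
      unfolding e_def by (simp add: add_pos_nonneg)
    have e_small: "e * \<bar>u$i\<bar> \<le> 1/2" for i
    proof -
      have "e * \<bar>u$i\<bar> \<le> e * (1 + norm u)"
        using component_le_norm_cart[of u i] \<open>0 < e\<close> by (intro mult_left_mono) auto
      also have "\<dots> = 1/2"
        unfolding e_def using norm_ge_zero[of u] by (simp add: field_simps add_nonneg_eq_0_iff)
      finally show ?thesis .
    qed
    obtain s where "s \<in> S" "s < t + e" using near[of "t + e"] \<open>0 < e\<close> by auto
    then obtain w where w: "\<And>i. 0 < w$i" "\<And>i. (B *v w)$i < s * w$i"
      by (auto simp: S_def)
    have "t \<le> s" unfolding t_def using \<open>s \<in> S\<close> S_bdd by (rule cInf_lower)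
    let ?A = "s *\<^sub>R mat 1 - B"
    have A: "(?A *v x)$i = s * x$i - (B *v x)$i" for x i
      by (simp add: matrix_vector_mult_diff_rdistrib scaleR_matrix_vector_assoc[symmetric])
    have u_nonneg: "0 \<le> u$k" for k
    proof (rule Z_matrix_monotone[of ?A w])
      show "?A$i$j \<le> 0" if "i \<noteq> j" for i j using that Bij[of i j] by (simp add: mat_def)
      show "0 < (?A *v w)$i" for i using w(2)[of i] by (simp add: A)
      show "0 \<le> (?A *v u)$i" for i
      proof -
        have "(s - t) * \<bar>u$i\<bar> \<le> e * \<bar>u$i\<bar>"
          using \<open>s < t + e\<close> by (intro mult_right_mono) auto
        then have "- ((s - t) * u$i) \<le> 1/2"
          using e_small[of i] \<open>t \<le> s\<close> by (smt (verit) minus_mult_right mult_left_mono)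
        then show ?thesis unfolding A using u[of i] by (simp add: left_diff_distrib)
      qed
    qed (rule w)
    have "0 < t * u$i" for i using u[of i] Bu[of u i] u_nonneg by simp
    then have u_pos: "0 < u$i" for i
      using t_nonneg by (metis less_eq_real_def mult_zero_left not_less_iff_gr_or_eq zero_less_mult_pos)
    have "(B *v u)$i < (t - e) * u$i" for i
      using u[of i] e_small[of i] u_pos[of i] by (simp add: algebra_simps)
    then have "t - e \<in> S" unfolding S_def using u_pos by auto
    then have "t \<le> t - e" unfolding t_def using S_bdd by (rule cInf_lower)
    then show False using \<open>0 < e\<close> by simp
  qed
  moreover have "\<exists>u. (\<forall>i. 0 < u$i) \<and> (\<forall>i. (B *v u)$i < s * u$i)" if "t < s" for s
  proof -
    obtain s' u where "s' < s" and u: "\<And>i. 0 < u$i" "\<And>i. (B *v u)$i < s' * u$i"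
      using near[OF \<open>t < s\<close>] by (auto simp: S_def)
    have "(B *v u)$i < s * u$i" for i
      using u(2)[of i] mult_strict_right_mono[OF \<open>s' < s\<close> u(1)[of i]] by linarith
    then show ?thesis using u(1) by blast
  qed
  ultimately show ?thesis by blast
qed

lemma M_matrix_off_diagonal:
  assumes "M_matrix A" "i \<noteq> j"
  shows "A$i$j \<le> 0"
  using assms by (auto simp: M_matrix_def less_eq_vec_def mat_def)

lemma M_matrix_positive_vector:
  fixes A :: "real^'n^'n"
  assumes "M_matrix A"
  obtains w where "\<And>i. 0 < w$i" "\<And>i. 0 < (A *v w)$i"
proof -
  obtain \<alpha> B where A: "A = \<alpha> *\<^sub>R mat 1 - B" and "0 \<le> B" and \<alpha>: "spectral_radius B < \<alpha>"
    using assms by (auto simp: M_matrix_def)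
  obtain t v where "v \<noteq> 0" "B *v v = t *\<^sub>R v"
    and t: "\<forall>s>t. \<exists>u. (\<forall>i. 0 < u$i) \<and> (\<forall>i. (B *v u)$i < s * u$i)"
    using nonneg_matrix_Perron_value[OF \<open>0 \<le> B\<close>] by blast
  then have "t < \<alpha>" using real_eigenvalue_le_spectral_radius \<alpha> by force
  then obtain w where w: "\<And>i. 0 < w$i" "\<And>i. (B *v w)$i < \<alpha> * w$i"
    using t by blast
  show ?thesis
  proof (rule that)
    show "0 < w$i" for i by (rule w)
    show "0 < (A *v w)$i" for i
      using w(2)[of i]
      by (simp add: A matrix_vector_mult_diff_rdistrib scaleR_matrix_vector_assoc[symmetric])
  qed
qed

section \<open>The selection matrices\<close>

lemma P_matrix_mult_component: "(P_matrix y *v x)$i = (if 0 \<le> y$i then x$i else 0)"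
proof -
  have "P_matrix y$i$j * x$j = (if i = j then if 0 \<le> y$i then x$j else 0 else 0)" for j
    by (simp add: P_matrix_def)
  then have "(P_matrix y *v x)$i = (\<Sum>j\<in>UNIV. if i = j then if 0 \<le> y$i then x$j else 0 else 0)"
    by (simp add: matrix_vector_mult_def)
  then show ?thesis by simp
qed

lemma P_matrix_idem [simp]: "P_matrix y *v (P_matrix y *v x) = P_matrix y *v x"
  by (simp add: vec_eq_iff P_matrix_mult_component)

text \<open>Applying \<open>P(x)\<close> to \<open>x\<close> itself yields its positive part, the largest vector \<open>P x\<close>.\<close>

lemma P_matrix_mult_le_self: "(P_matrix y *v x)$i \<le> (P_matrix x *v x)$i"
  by (simp add: P_matrix_mult_component)

lemma zero_eq_P_matrix: "0 = P_matrix (- 1)"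
  by (simp add: vec_eq_iff P_matrix_def)

lemma finite_range_P_matrix: "finite (range (P_matrix :: real^'n \<Rightarrow> real^'n^'n))"
proof -
  have "range (P_matrix :: real^'n \<Rightarrow> real^'n^'n) \<subseteq>
      range (\<lambda>S. \<chi> i j. if i = j \<and> i \<in> S then 1 else 0)"
  proof
    fix Q assume "Q \<in> range (P_matrix :: real^'n \<Rightarrow> real^'n^'n)"
    then obtain y :: "real^'n" where "Q = P_matrix y" by auto
    then have "Q = (\<chi> i j. if i = j \<and> i \<in> {i. 0 \<le> y$i} then 1 else 0)"
      by (simp add: P_matrix_def)
    then show "Q \<in> range (\<lambda>S. \<chi> i j. if i = j \<and> i \<in> S then 1 else 0)" by blast
  qed
  then show ?thesis by (rule finite_subset) simp
qed

lemma system_apply: "(mat 1 + T ** P) *v x = x + T *v (P *v x)"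
  by (simp add: matrix_vector_mult_add_rdistrib matrix_vector_mul_assoc)

section \<open>Policy iteration\<close>

text \<open>The common content of (T1) and (T2) from which everything else follows.\<close>

locale semipositive_Z_matrix =
  fixes T :: "real^'n^'n" and w :: "real^'n"
  assumes off_diagonal: "i \<noteq> j \<Longrightarrow> T$i$j \<le> 0"
    and w_pos: "0 < w$i"
    and Tw_nonneg: "0 \<le> (T *v w)$i"
begin

text \<open>\<open>I + P T\<close> inherits the sign pattern of \<open>T\<close>, and it maps \<open>w\<close> to a vector \<open>\<ge> w\<close>.\<close>

lemma policy_matrix_monotone:
  assumes "\<And>i. 0 \<le> (x + P_matrix y *v (T *v x))$i"
  shows "0 \<le> x$k"
proof (rule Z_matrix_monotone[of "mat 1 + P_matrix y ** T" w])
  let ?A = "mat 1 + P_matrix y ** T"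
  have A: "?A *v x = x + P_matrix y *v (T *v x)" for x by (rule system_apply)
  show "?A$i$j \<le> 0" if "i \<noteq> j" for i j
  proof -
    have "(P_matrix y ** T)$i$j = (P_matrix y *v column j T)$i"
      by (simp add: matrix_matrix_mult_def matrix_vector_mult_def column_def)
    then show ?thesis
      using that off_diagonal[OF that] by (simp add: P_matrix_mult_component column_def mat_def)
  qed
  show "0 < w$i" for i by (rule w_pos)
  show "0 < (?A *v w)$i" for i
    unfolding A using w_pos[of i] Tw_nonneg[of i] by (simp add: P_matrix_mult_component)
  show "0 \<le> (?A *v x)$i" for i unfolding A by (rule assms)
qed

text \<open>
  A kernel vector \<open>x\<close> of \<open>I + T P\<close> gives the kernel vector \<open>z = P x\<close> of the monotone matrix
  \<open>I + P T\<close>; so \<open>z = 0\<close> and \<open>x = - T z = 0\<close>.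
\<close>

lemma system_ex1: "\<exists>!x. (mat 1 + T ** P_matrix y) *v x = b"
proof -
  let ?f = "\<lambda>x. (mat 1 + T ** P_matrix y) *v x"
  have lin: "linear ?f" by (rule matrix_vector_mul_linear)
  have "x = 0" if "?f x = 0" for x
  proof -
    define z where "z = P_matrix y *v x"
    have x: "x + T *v z = 0" using that by (simp only: system_apply z_def)
    then have "P_matrix y *v (x + T *v z) = 0" by simp
    then have z: "z + P_matrix y *v (T *v z) = 0"
      by (simp add: matrix_vector_right_distrib z_def)
    have "0 \<le> z$i" for i by (rule policy_matrix_monotone[where y = y]) (simp add: z)
    moreover have "0 \<le> (- z)$i" for i
    proof (rule policy_matrix_monotone[where y = y])
      have "- z + P_matrix y *v (T *v (- z)) = - (z + P_matrix y *v (T *v z))"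
        by (simp add: vec.neg)
      then show "0 \<le> (- z + P_matrix y *v (T *v (- z)))$j" for j by (simp add: z)
    qed
    ultimately have "z = 0" by (auto simp: vec_eq_iff intro: antisym)
    then show ?thesis using x by simp
  qed
  then have "inj ?f" by (simp add: linear_injective_0[OF lin])
  moreover then have "surj ?f" by (rule linear_inj_imp_surj[OF lin])
  ultimately show ?thesis by (metis injD surjD)
qed

text \<open>
  The comparison behind both monotonicity and uniqueness. With \<open>z = P(y) x\<close> and \<open>z' = P(y') x'\<close>,
  subtracting the two systems gives \<open>(I + P(y') T) (z' - z) = P(y') x - P(y) x\<close>, so the sign of
  the right-hand side, which does not mention \<open>x'\<close>, determines the sign of \<open>z' - z\<close>.
\<close>

lemma policy_comparison:
  assumes x: "(mat 1 + T ** P_matrix y) *v x = b"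
    and x': "(mat 1 + T ** P_matrix y') *v x' = b"
  shows "P_matrix y *v x \<le> P_matrix y' *v x \<Longrightarrow> P_matrix y *v x \<le> P_matrix y' *v x'"
    and "P_matrix y' *v x \<le> P_matrix y *v x \<Longrightarrow> P_matrix y' *v x' \<le> P_matrix y *v x"
proof -
  define z z' where "z = P_matrix y *v x" and "z' = P_matrix y' *v x'"
  have b: "x + T *v z = b" "x' + T *v z' = b"
    using x x' by (simp_all only: system_apply z_def z'_def)
  have "T *v (z' - z) = T *v z' - T *v z"
    by (rule matrix_vector_mult_diff_distrib)
  also have "\<dots> = x - x'" using b by (simp add: algebra_simps)
  finally have Tz: "T *v (z' - z) = x - x'" .
  have res: "z' - z + P_matrix y' *v (T *v (z' - z)) = P_matrix y' *v x - z"
    unfolding Tz by (simp add: matrix_vector_mult_diff_distrib z'_def)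
  have "T *v (z - z') = x' - x"
    using Tz by (simp add: matrix_vector_mult_diff_distrib algebra_simps)
  then have res': "z - z' + P_matrix y' *v (T *v (z - z')) = z - P_matrix y' *v x"
    by (simp add: matrix_vector_mult_diff_distrib z'_def)
  {
    assume "P_matrix y *v x \<le> P_matrix y' *v x"
    then have "0 \<le> (z' - z + P_matrix y' *v (T *v (z' - z)))$i" for i
      unfolding res by (simp add: less_eq_vec_def z_def)
    then have "0 \<le> (z' - z)$i" for i by (rule policy_matrix_monotone)
    then show "P_matrix y *v x \<le> P_matrix y' *v x'" by (simp add: less_eq_vec_def z_def z'_def)
  next
    assume "P_matrix y' *v x \<le> P_matrix y *v x"
    then have "0 \<le> (z - z' + P_matrix y' *v (T *v (z - z')))$i" for i
      unfolding res' by (simp add: less_eq_vec_def z_def)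
    then have "0 \<le> (z - z')$i" for i by (rule policy_matrix_monotone)
    then show "P_matrix y' *v x' \<le> P_matrix y *v x" by (simp add: less_eq_vec_def z_def z'_def)
  }
qed

lemma eq_if_selected_eq:
  assumes "(mat 1 + T ** P) *v x = b" "(mat 1 + T ** P') *v x' = b" "P *v x = P' *v x'"
  shows "x = x'"
  using assms by (metis add_right_cancel system_apply)

text \<open>
  Since \<open>P(x)\<close> maximises \<open>P x\<close> over all policies \<open>P\<close>, the second comparison, started at the policy
  of one solution, bounds the positive part of the other; by symmetry the two positive parts agree.
\<close>

lemma solution_unique:
  assumes "solves_pls T b x" "solves_pls T b x'"
  shows "x = x'"
proof -
  have le: "P_matrix x' *v x' \<le> P_matrix x *v x"
    if "solves_pls T b x" "solves_pls T b x'" for x x'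
    using that unfolding solves_pls_def
    by (rule policy_comparison(2)) (simp add: less_eq_vec_def P_matrix_mult_le_self)
  have "P_matrix x *v x = P_matrix x' *v x'"
    using assms le by (simp add: order_antisym)
  then show ?thesis
    using assms eq_if_selected_eq unfolding solves_pls_def by blast
qed

lemma iteration_policy:
  assumes "is_iteration T b Ps xs"
  obtains y where "Ps k = P_matrix y"
proof (cases k)
  case 0
  then have "Ps k = P_matrix (- 1)"
    using assms zero_eq_P_matrix by (simp add: is_iteration_def)
  then show ?thesis by (rule that)
next
  case (Suc j)
  then have "Ps k = P_matrix (xs k)" using assms by (simp add: is_iteration_def)
  then show ?thesis by (rule that)
qed

lemma iteration_step_ex1:
  assumes "is_iteration T b Ps xs"
  shows "\<exists>!y. (mat 1 + T ** Ps k) *v y = b"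
proof -
  obtain y where "Ps k = P_matrix y" using iteration_policy[OF assms] .
  then show ?thesis using system_ex1 by simp
qed

lemma iteration_exists: "\<exists>Ps xs. is_iteration T b Ps xs"
proof -
  define sol where "sol P = (SOME x. (mat 1 + T ** P) *v x = b)" for P
  define Ps where "Ps k = ((\<lambda>P. P_matrix (sol P)) ^^ k) 0" for k
  have sol: "(mat 1 + T ** P_matrix y) *v sol (P_matrix y) = b" for y
    unfolding sol_def by (rule someI_ex) (rule ex1_implies_ex[OF system_ex1])
  have "\<exists>y. Ps k = P_matrix y" for k
    by (cases k) (auto simp: Ps_def zero_eq_P_matrix)
  then have "(mat 1 + T ** Ps k) *v sol (Ps k) = b" for k
    using sol by metis
  then have "is_iteration T b Ps (\<lambda>k. sol (Ps (k - 1)))"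
    by (simp add: is_iteration_def Ps_def)
  then show ?thesis by blast
qed

text \<open>
  The iterates \<open>z\<^sup>k\<^sup>+\<^sup>1 = P\<^sup>k x\<^sup>k\<^sup>+\<^sup>1\<close> increase and, being determined by \<open>P\<^sup>k\<close>, take finitely many
  values; hence they stay at a maximal one. Equal consecutive \<open>z\<close> mean equal consecutive \<open>x\<close>, and
  then \<open>x\<close> solves the system for its own selection matrix.
\<close>

lemma iteration_reaches_solution:
  assumes it: "is_iteration T b Ps xs"
  obtains K x where "solves_pls T b x" "\<And>k. K \<le> k \<Longrightarrow> xs k = x"
proof -
  have step: "(mat 1 + T ** Ps k) *v xs (Suc k) = b"
    and Ps_Suc: "Ps (Suc k) = P_matrix (xs (Suc k))" for k
    using it by (auto simp: is_iteration_def)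
  define z where "z k = Ps k *v xs (Suc k)" for k
  have "z k \<le> z (Suc k)" for k
  proof -
    obtain y where y: "Ps k = P_matrix y" using iteration_policy[OF it] .
    show ?thesis
      unfolding z_def y Ps_Suc
    proof (rule policy_comparison(1))
      show "(mat 1 + T ** P_matrix y) *v xs (Suc k) = b"
        using step[of k] by (simp add: y)
      show "(mat 1 + T ** P_matrix (xs (Suc k))) *v xs (Suc (Suc k)) = b"
        using step[of "Suc k"] by (simp add: Ps_Suc)
    qed (simp add: less_eq_vec_def P_matrix_mult_le_self)
  qed
  then have mono: "z j \<le> z k" if "j \<le> k" for j k
    using that by (rule lift_Suc_mono_le)
  have "finite (range z)"
  proof (rule finite_subset)
    show "range z \<subseteq> (\<lambda>P. P *v (THE x. (mat 1 + T ** P) *v x = b)) ` range P_matrix"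
    proof
      fix u assume "u \<in> range z"
      then obtain k where "u = z k" by auto
      moreover have "(THE x. (mat 1 + T ** Ps k) *v x = b) = xs (Suc k)"
        using the1_equality[OF iteration_step_ex1[OF it] step] .
      moreover have "Ps k \<in> range P_matrix" using iteration_policy[OF it] by blast
      ultimately show "u \<in> (\<lambda>P. P *v (THE x. (mat 1 + T ** P) *v x = b)) ` range P_matrix"
        by (auto simp: z_def intro!: image_eqI[of _ _ "Ps k"])
    qed
  qed (simp add: finite_range_P_matrix)
  then obtain K where K: "\<And>k. z K \<le> z k \<Longrightarrow> z k = z K"
    using finite_has_maximal[of "range z"] by auto metis
  have const: "xs (Suc k) = xs (Suc K)" if "K \<le> k" for k
    using eq_if_selected_eq[OF step step] K[OF mono[OF that]] by (simp add: z_def)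
  have "solves_pls T b (xs (Suc K))"
    using step[of "Suc K"] const[of "Suc K"] by (simp add: Ps_Suc solves_pls_def)
  moreover have "xs k = xs (Suc K)" if "Suc K \<le> k" for k
    using const[of "k - 1"] that by (cases k) auto
  ultimately show ?thesis using that by blast
qed

end

text \<open>Under (T2) the sign pattern of \<open>T\<close> is that of the M-matrix \<open>T + I\<close> off the diagonal.\<close>

lemma T1_or_T2_imp_semipositive_Z_matrix:
  assumes "property_T1 T \<or> property_T2 T"
  shows "\<exists>w. semipositive_Z_matrix T w"
  using assms
proof
  assume "property_T1 T"
  then have M: "M_matrix T" by (simp add: property_T1_def)
  then obtain w where "\<And>i. 0 < w$i" "\<And>i. 0 < (T *v w)$i"
    by (rule M_matrix_positive_vector) blast
  then have "semipositive_Z_matrix T w"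
    using M_matrix_off_diagonal[OF M] by unfold_locales (auto intro: less_imp_le)
  then show ?thesis ..
next
  assume T2: "property_T2 T"
  then obtain w where w: "\<And>i. 0 < w$i" and "null_space T = span {w}"
    by (auto simp: property_T2_def)
  then have "T *v w = 0" using span_base[of w "{w}"] by (auto simp: null_space_def)
  have "diagonal_matrix (mat 1 :: real^'a^'a)" "0 \<le> (mat 1 :: real^'a^'a)" "mat 1 \<noteq> (0 :: real^'a^'a)"
    by (auto simp: diagonal_matrix_def less_eq_vec_def mat_def vec_eq_iff)
  then have "M_matrix (T + mat 1)" using T2 by (auto simp: property_T2_def)
  then have "T$i$j \<le> 0" if "i \<noteq> j" for i j
    using M_matrix_off_diagonal[of "T + mat 1" i j] that by (simp add: mat_def)
  then have "semipositive_Z_matrix T w"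
    using w \<open>T *v w = 0\<close> by unfold_locales auto
  then show ?thesis ..
qed

theorem mainTheorem8:
  fixes T :: "real^'n^'n" and b :: "real^'n"
  assumes "irreducible_matrix T"
    and "property_T1 T \<or> property_T2 T"
  shows "\<exists>x_star. solves_pls T b x_star \<and> (\<forall>x. solves_pls T b x \<longrightarrow> x = x_star) \<and>
    (\<exists>Ps xs. is_iteration T b Ps xs) \<and>
    (\<forall>Ps xs. is_iteration T b Ps xs \<longrightarrow>
       (\<forall>k. \<exists>!y. (mat 1 + T ** Ps k) *v y = b) \<and>
       (\<exists>K. \<forall>k\<ge>K. xs k = x_star))"
proof -
  obtain w where "semipositive_Z_matrix T w"
    using T1_or_T2_imp_semipositive_Z_matrix[OF assms(2)] by blast
  then interpret semipositive_Z_matrix T w .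
  obtain Ps xs where it: "is_iteration T b Ps xs" using iteration_exists by blast
  obtain x_star where x_star: "solves_pls T b x_star"
    using iteration_reaches_solution[OF it] by metis
  have "\<exists>K. \<forall>k\<ge>K. xs k = x_star" if "is_iteration T b Ps xs" for Ps xs
    using iteration_reaches_solution[OF that] solution_unique[OF x_star] by metis
  then show ?thesis
    using x_star solution_unique it iteration_step_ex1 by blast
qed

end
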